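(* For every real $\tau\geqslant 1$ there exist a strictly increasing sequence of natural numbers $f(n)$, $n\in\mathbb{N}$, with $f(n)=O(n^\tau)$, and a constant $c>0$ such that $$\dim\mathcal{G}_{f,c}=1-1/\tau,$$ where $\dim$ denotes Hausdorff dimension.
   Context: Write $\mathbf{e}(z)=\exp(2\pi i z)$ and $\mathsf{T}=[0,1]$. For a real sequence $f(n)$, $x\in\mathsf{T}$ and $N\in\mathbb{N}$ let $V_f(x;N)=\sum_{n=1}^N\mathbf{e}(xf(n))$, and for $c>0$ let $\mathcal{G}_{f,c}=\{x\in\mathsf{T}:\ |V_f(x;N)|\geqslant cN\text{ for infinitely many }N\in\mathbb{N}\}$. *)

theory Defs
  imports "HOL-Analysis.Analysis" "HOL-Library.Landau_Symbols"
begin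

definition ee :: "complex \<Rightarrow> complex" where
  "ee z = exp (2 * of_real pi * \<i> * z)"

definition V :: "(nat \<Rightarrow> real) \<Rightarrow> real \<Rightarrow> nat \<Rightarrow> complex" where
  "V f x N = (\<Sum>n=1..N. ee (of_real (x * f n)))"

definition large_sum_set :: "(nat \<Rightarrow> real) \<Rightarrow> real \<Rightarrow> real set" where
  "large_sum_set f c = {x \<in> {0..1}. infinite {N. 1 \<le> N \<and> norm (V f x N) \<ge> c * real N}}"

text \<open>
  The value \<open>diam U ^ s\<close> with the usual conventions: the empty set contributes \<open>0\<close>, and
  \<open>diam U ^ 0 = 1\<close> for every nonempty \<open>U\<close> (whereas \<open>0 powr 0 = 0\<close>).
\<close>

definition diam_pow :: "real \<Rightarrow> 'a::metric_space set \<Rightarrow> ennreal" where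
  "diam_pow s U =
     (if U = {} then 0 else if s = 0 then 1 else ennreal (diameter U powr s))"

text \<open>
  Boundedness is required explicitly because \<^const>\<open>diameter\<close> is a meaningless real number on
  unbounded sets.  Finite covers are included by padding with the empty set.
\<close>

definition delta_cover :: "real \<Rightarrow> 'a::metric_space set \<Rightarrow> (nat \<Rightarrow> 'a set) \<Rightarrow> bool" where
  "delta_cover \<delta> E U \<longleftrightarrow>
     E \<subseteq> (\<Union>i. U i) \<and> (\<forall>i. bounded (U i) \<and> diameter (U i) \<le> \<delta>)"

definition hausdorff_premeasure :: "real \<Rightarrow> real \<Rightarrow> 'a::metric_space set \<Rightarrow> ennreal" where
  "hausdorff_premeasure s \<delta> E = (INF U \<in> {U. delta_cover \<delta> E U}. \<Sum>i. diam_pow s (U i))"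

text \<open>The premeasure is antitone in \<open>\<delta>\<close>, so the supremum is its limit as \<open>\<delta> \<rightarrow> 0\<close>.\<close>

definition hausdorff_measure :: "real \<Rightarrow> 'a::metric_space set \<Rightarrow> ennreal" where
  "hausdorff_measure s E = (SUP \<delta> \<in> {0<..}. hausdorff_premeasure s \<delta> E)"

text \<open>The values are extended reals so that the infimum over the empty set is \<open>\<infinity>\<close>.\<close>

definition hausdorff_dim :: "'a::metric_space set \<Rightarrow> ereal" where
  "hausdorff_dim E = (INF s \<in> {s. 0 \<le> s \<and> hausdorff_measure s E = 0}. ereal s)"

end

theory Submission
  imports Defs
begin

text \<open>
  Upper bound, valid for every injective \<open>f(n) = O(n powr \<tau>)\<close>: at the points \<open>i / R\<close> with \<open>R\<close> a large
  multiple of \<open>N powr \<tau>\<close>, orthogonality gives mean square \<open>N\<close> for the sums of length \<open>N\<close>, while each sum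
  varies little over \<open>1 / R\<close>.  So the points with sums of size \<open>c N\<close> lie in \<open>O(R / N)\<close> intervals of
  length \<open>1 / R\<close>, which is critical for the exponent \<open>1 - 1 / \<tau>\<close>.

  Lower bound: take \<open>f(n) = n * 2 ^ q\<^sub>j\<close> with \<open>q\<^sub>j = \<lfloor>2 (\<tau> - 1) j\<rfloor>\<close> for \<open>4 ^ j \<le> n < 4 ^ (j + 1)\<close>.
  The sum up to \<open>4 ^ (j + 1) - 1\<close> is large whenever about \<open>2 j\<close> binary digits of \<open>x\<close> starting at position
  \<open>q\<^sub>j\<close> vanish.  Imposing this for a geometric sequence of \<open>j\<close> with large ratio forces little more than
  a proportion \<open>1 / \<tau>\<close> of the digits up to any position.  Writing the binary digits of \<open>t \<in> [0, 1)\<close> at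
  the remaining positions transports Lebesgue measure to a measure on the large-sum set to which the
  mass distribution principle applies for the given exponent below \<open>1 - 1 / \<tau>\<close>.
\<close>

subsection \<open>Exponential sums\<close>

lemma ee_of_real: "ee (of_real x) = cis (2 * pi * x)"
  by (simp add: ee_def cis_conv_exp mult_ac)

lemma norm_cis_diff_le: "norm (cis a - cis b) \<le> \<bar>a - b\<bar>"
proof -
  have "cis a - cis b = cis b * (cis (a - b) - 1)"
    by (simp add: right_diff_distrib cis_mult)
  then have "norm (cis a - cis b) = norm (exp (\<i> * of_real (a - b)) - 1)"
    by (simp add: norm_mult cis_conv_exp)
  also have "\<dots> = 2 * \<bar>sin ((a - b) / 2)\<bar>"
    using dist_exp_i_1 by blast
  also have "\<dots> \<le> \<bar>a - b\<bar>"
    using abs_sin_x_le_abs_x[of "(a - b) / 2"] by simp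
  finally show ?thesis .
qed

lemma V_lipschitz:
  assumes "\<And>n. n \<in> {1..N} \<Longrightarrow> \<bar>f n\<bar> \<le> B"
  shows "norm (V f x N - V f y N) \<le> 2 * pi * real N * B * \<bar>x - y\<bar>"
proof -
  have "norm (V f x N - V f y N) \<le> (\<Sum>n=1..N. norm (cis (2 * pi * (x * f n)) - cis (2 * pi * (y * f n))))"
    unfolding V_def ee_of_real sum_subtractf[symmetric] by (rule norm_sum)
  also have "\<dots> \<le> (\<Sum>n=1..N. 2 * pi * B * \<bar>x - y\<bar>)"
  proof (rule sum_mono)
    fix n assume n: "n \<in> {1..N}"
    have "norm (cis (2 * pi * (x * f n)) - cis (2 * pi * (y * f n))) \<le> \<bar>2 * pi * (x * f n) - 2 * pi * (y * f n)\<bar>"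
      by (rule norm_cis_diff_le)
    also have "\<dots> = 2 * pi * \<bar>f n\<bar> * \<bar>x - y\<bar>"
      by (simp add: abs_mult flip: right_diff_distrib left_diff_distrib)
    also have "\<dots> \<le> 2 * pi * B * \<bar>x - y\<bar>"
      using assms[OF n] by (intro mult_right_mono mult_left_mono) auto
    finally show "norm (cis (2 * pi * (x * f n)) - cis (2 * pi * (y * f n))) \<le> 2 * pi * B * \<bar>x - y\<bar>" .
  qed
  also have "\<dots> = 2 * pi * real N * B * \<bar>x - y\<bar>" by simp
  finally show ?thesis .
qed

lemma norm_V_diff_le:
  assumes "M \<le> N"
  shows "norm (V f x N - V f x M) \<le> real (N - M)"
proof -
  have "V f x N = V f x M + (\<Sum>n\<in>{M<..N}. ee (of_real (x * f n)))"
    unfolding V_def using assms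
    by (subst sum.union_disjoint[symmetric]) (auto intro!: sum.cong)
  then have "norm (V f x N - V f x M) \<le> (\<Sum>n\<in>{M<..N}. norm (ee (of_real (x * f n))))"
    by (simp add: norm_sum)
  then show ?thesis unfolding ee_of_real by simp
qed

text \<open>A geometric sum whose ratio is an \<open>R\<close>-th root of unity; the ratio differs
  from 1 because \<open>R\<close> cannot divide a nonzero \<open>k\<close> smaller than
  \<open>R\<close> in modulus.\<close>

lemma sum_cis_roots_of_unity:
  fixes k :: int
  assumes R: "R > 0" and k: "\<bar>k\<bar> < int R"
  shows "(\<Sum>i<R. cis (2 * pi * (real i / real R * of_int k))) = (if k = 0 then of_nat R else 0)"
proof (cases "k = 0")
  case False
  define z where "z = cis (2 * pi * (of_int k / real R))"
  have zi: "cis (2 * pi * (real i / real R * of_int k)) = z ^ i" for i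
    unfolding z_def Complex.DeMoivre by (rule arg_cong[where f = cis]) simp
  have "z ^ R = cis (2 * pi * of_int k)"
    using R by (simp add: z_def Complex.DeMoivre mult_ac)
  then have zR: "z ^ R = 1" by (simp add: cis_multiple_2pi)
  have "z \<noteq> 1"
  proof
    assume "z = 1"
    then have "exp (\<i> * of_real (2 * pi * (of_int k / real R))) = 1" by (simp add: z_def cis_conv_exp)
    then obtain n :: int where n: "2 * pi * (of_int k / real R) = of_int (2 * n) * pi"
      unfolding exp_eq_1 by auto
    then have "real_of_int k = of_int (n * int R)" using R by (simp add: field_simps)
    then have "k = n * int R" by linarith
    with k False show False
      using R by (simp add: abs_mult)
  qed
  then show ?thesis unfolding zi using False zR by (simp add: geometric_sum)
qed simp

text \<open>Discrete Parseval identity: after expanding the square, the sum over \<open>i\<close>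
  kills every off-diagonal pair, since injectivity and the bound \<open>R\<close> keep the
  frequencies distinct modulo \<open>R\<close>.\<close>

lemma sum_norm_V_sq:
  fixes f :: "nat \<Rightarrow> nat"
  assumes R: "R > 0" and inj: "inj_on f {1..N}" and less: "\<And>n. n \<in> {1..N} \<Longrightarrow> f n < R"
  shows "(\<Sum>i<R. (norm (V (\<lambda>n. real (f n)) (real i / real R) N))\<^sup>2) = real R * real N"
proof -
  let ?e = "\<lambda>i n m. cis (2 * pi * (real i / real R * of_int (int (f n) - int (f m))))"
  have "complex_of_real ((norm (V (\<lambda>n. real (f n)) (real i / real R) N))\<^sup>2)
          = (\<Sum>n=1..N. \<Sum>m=1..N. ?e i n m)" for i
    unfolding complex_norm_square V_def ee_of_real
    by (simp add: sum_product cis_cnj cis_mult algebra_simps)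
  then have "complex_of_real (\<Sum>i<R. (norm (V (\<lambda>n. real (f n)) (real i / real R) N))\<^sup>2)
          = (\<Sum>i<R. \<Sum>n=1..N. \<Sum>m=1..N. ?e i n m)" by simp
  also have "\<dots> = (\<Sum>n=1..N. \<Sum>i<R. \<Sum>m=1..N. ?e i n m)"
    by (rule sum.swap)
  also have "\<dots> = (\<Sum>n=1..N. \<Sum>m=1..N. \<Sum>i<R. ?e i n m)"
    by (intro sum.cong refl sum.swap)
  also have "\<dots> = (\<Sum>n=1..N. \<Sum>m=1..N. if n = m then of_nat R else 0)"
  proof (intro sum.cong refl)
    fix n m assume nm: "n \<in> {1..N}" "m \<in> {1..N}"
    have "(\<Sum>i<R. ?e i n m) = (if int (f n) - int (f m) = 0 then of_nat R else 0)"
      using less[OF nm(1)] less[OF nm(2)] by (intro sum_cis_roots_of_unity R) auto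
    moreover have "int (f n) - int (f m) = 0 \<longleftrightarrow> n = m"
      using inj nm by (auto dest: inj_onD)
    ultimately show "(\<Sum>i<R. ?e i n m) = (if n = m then of_nat R else 0)" by simp
  qed
  also have "\<dots> = complex_of_real (real R * real N)" by simp
  finally show ?thesis unfolding of_real_eq_iff .
qed

text \<open>Moving \<open>x\<close> to the left end of its cell of length \<open>1 / R\<close> costs
  at most \<open>c / 2 * N\<close> by \<open>V_lipschitz\<close>, so the index of that cell lies in
  \<open>I\<close>. Chebyshev's inequality with the mean square from \<open>sum_norm_V_sq\<close>
  then bounds \<open>card I\<close>.\<close>

lemma large_sums_cover:
  fixes f :: "nat \<Rightarrow> nat"
  assumes R: "R > 0" and N: "N > 0" and c: "c > 0"
    and inj: "inj_on f {1..N}" and less: "\<And>n. n \<in> {1..N} \<Longrightarrow> f n < R"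
    and B: "\<And>n. n \<in> {1..N} \<Longrightarrow> real (f n) \<le> B" "4 * pi * B \<le> c * real R"
  defines "I \<equiv> {i. i < R \<and> norm (V (\<lambda>n. real (f n)) (real i / real R) N) \<ge> c / 2 * real N}"
  shows "{x \<in> {0..1}. norm (V (\<lambda>n. real (f n)) x N) \<ge> c * real N}
           \<subseteq> (\<Union>i\<in>I. {real i / real R .. real (Suc i) / real R})" (is ?cover)
    and "real (card I) \<le> 4 * real R / (c\<^sup>2 * real N)" (is ?card)
proof -
  show ?cover
  proof
    fix x assume x: "x \<in> {x \<in> {0..1}. norm (V (\<lambda>n. real (f n)) x N) \<ge> c * real N}"
    \<comment> \<open>At \<open>x = 1\<close> the floor of \<open>x * R\<close> is \<open>R\<close>,
      which is not an admissible index, so the last cell is taken instead.\<close>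
    have "\<exists>i<R. real i / real R \<le> x \<and> x \<le> real (Suc i) / real R"
    proof (cases "x = 1")
      case True
      then show ?thesis using R by (intro exI[of _ "R - 1"]) (auto simp: field_simps)
    next
      case False
      define i where "i = nat \<lfloor>x * real R\<rfloor>"
      have i: "real i \<le> x * real R" "x * real R < real (Suc i)"
        using x R unfolding i_def by (auto simp: of_nat_nat) linarith+
      have "x * real R < real R" using x False R by auto
      then have "i < R" using i(1) by linarith
      with i R show ?thesis by (intro exI[of _ i]) (auto simp: field_simps)
    qed
    then obtain i where i: "i < R" "real i / real R \<le> x" "x \<le> real (Suc i) / real R" by blast
    have "0 \<le> B" using B(1)[of 1] N by (simp add: order_trans[OF of_nat_0_le_iff])
    have d: "\<bar>x - real i / real R\<bar> \<le> 1 / real R"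
      using i by (simp add: add_divide_distrib)
    have "norm (V (\<lambda>n. real (f n)) x N - V (\<lambda>n. real (f n)) (real i / real R) N)
            \<le> 2 * pi * real N * B * \<bar>x - real i / real R\<bar>"
      using B(1) by (intro V_lipschitz) auto
    also have "\<dots> \<le> 2 * pi * real N * B * (1 / real R)"
      using \<open>0 \<le> B\<close> d by (intro mult_left_mono) auto
    also have "\<dots> = (4 * pi * B) * (real N / (2 * real R))" by simp
    also have "\<dots> \<le> (c * real R) * (real N / (2 * real R))"
      using B(2) by (intro mult_right_mono) auto
    also have "\<dots> = c / 2 * real N" using R by simp
    finally have "norm (V (\<lambda>n. real (f n)) x N - V (\<lambda>n. real (f n)) (real i / real R) N) \<le> c / 2 * real N" .
    moreover have "norm (V (\<lambda>n. real (f n)) x N) \<ge> c * real N" using x by simp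
    ultimately have "norm (V (\<lambda>n. real (f n)) (real i / real R) N) \<ge> c / 2 * real N"
      using norm_triangle_ineq2[of "V (\<lambda>n. real (f n)) x N" "V (\<lambda>n. real (f n)) (real i / real R) N"] by linarith
    then show "x \<in> (\<Union>i\<in>I. {real i / real R .. real (Suc i) / real R})"
      using i unfolding I_def by auto
  qed
  have "real (card I) * (c / 2 * real N)\<^sup>2 = (\<Sum>i\<in>I. (c / 2 * real N)\<^sup>2)" by simp
  also have "\<dots> \<le> (\<Sum>i\<in>I. (norm (V (\<lambda>n. real (f n)) (real i / real R) N))\<^sup>2)"
    using c by (intro sum_mono power_mono) (auto simp: I_def)
  also have "\<dots> \<le> (\<Sum>i<R. (norm (V (\<lambda>n. real (f n)) (real i / real R) N))\<^sup>2)"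
    by (intro sum_mono2) (auto simp: I_def)
  also have "\<dots> = real R * real N" by (rule sum_norm_V_sq[OF R inj less])
  finally show ?card using N c by (simp add: field_simps power2_eq_square)
qed

subsection \<open>Hausdorff measure\<close>

text \<open>Allows a cover made of countably many families, one for each length of the sums;
  \<open>prod_decode\<close> merges them into a single sequence.\<close>

lemma hausdorff_premeasure_le_double_suminf:
  assumes "E \<subseteq> (\<Union>k i. U k i)" and "\<And>k i. bounded (U k i)" and "\<And>k i. diameter (U k i) \<le> \<delta>"
  shows "hausdorff_premeasure s \<delta> E \<le> (\<Sum>k. \<Sum>i. diam_pow s (U k i))"
proof -
  define W where "W = case_prod U \<circ> prod_decode"
  have "E \<subseteq> (\<Union>j. W j)"
  proof
    fix x assume "x \<in> E"
    then obtain k i where "x \<in> U k i" using assms(1) by blast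
    then have "x \<in> W (prod_encode (k, i))" by (simp add: W_def)
    then show "x \<in> (\<Union>j. W j)" by blast
  qed
  then have "delta_cover \<delta> E W"
    using assms(2,3) by (auto simp: delta_cover_def W_def split: prod.split)
  then have "hausdorff_premeasure s \<delta> E \<le> (\<Sum>j. diam_pow s (W j))"
    unfolding hausdorff_premeasure_def by (intro INF_lower) simp
  also have "(\<Sum>j. diam_pow s (W j)) = (\<Sum>k. \<Sum>i. diam_pow s (U k i))"
    unfolding W_def comp_def by (rule suminf_ennreal_2dimen[where f = "\<lambda>x. diam_pow s (case_prod U x)"]) simp
  finally show ?thesis .
qed

text \<open>The mass distribution principle for the image of \<open>M\<close> under \<open>\<psi>\<close>.\<close>

lemma hausdorff_measure_pos_if_ball_bound:
  fixes \<psi> :: "'b \<Rightarrow> 'a::metric_space"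
  assumes S: "S \<in> sets M" "emeasure M S > 0" and \<psi>: "\<psi> \<in> borel_measurable M"
    and E: "\<psi> ` S \<subseteq> E" and s: "s \<ge> 0" and \<rho>: "\<rho> > 0" and C: "C > 0"
    and ball: "\<And>x r. 0 < r \<Longrightarrow> r \<le> \<rho> \<Longrightarrow> emeasure M (\<psi> -` cball x r \<inter> S) \<le> ennreal (C * r powr s)"
  shows "hausdorff_measure s E > 0"
proof -
  have meas: "\<psi> -` cball x r \<inter> S \<in> sets M" for x r
  proof -
    have "\<psi> -` cball x r \<inter> S = (\<psi> -` cball x r \<inter> space M) \<inter> S"
      using sets.sets_into_space[OF S(1)] by blast
    also have "\<dots> \<in> sets M"
      using \<psi> S(1) by (intro sets.Int measurable_sets[OF \<psi>]) auto
    finally show ?thesis .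
  qed
  \<comment> \<open>The preimage of an arbitrary \<open>U\<close> need not be measurable, so a
    nonempty \<open>U\<close> is enlarged to the closed ball of radius \<open>diameter U\<close>
    about one of its points.\<close>
  have U: "\<exists>B\<in>sets M. \<psi> -` U \<inter> S \<subseteq> B \<and> emeasure M B \<le> ennreal C * diam_pow s U"
    if U: "bounded U" "diameter U \<le> \<rho>" for U
  proof (cases "U = {}")
    case True
    then show ?thesis by (intro bexI[of _ "{}"]) auto
  next
    case False
    then obtain x where x: "x \<in> U" by blast
    have sub: "U \<subseteq> cball x (diameter U)"
      using diameter_bounded_bound[OF U(1) x] by (auto simp: subset_iff)
    have d0: "diameter U \<ge> 0" using U(1) by (rule diameter_ge_0)
    \<comment> \<open>The assumption \<open>ball\<close> excludes radius 0. For a one-point set the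
      bound is read off at radius \<open>\<rho>\<close> if \<open>s = 0\<close>, where
      \<open>diam_pow\<close> is 1, and otherwise by letting the radius tend to 0.\<close>
    consider "diameter U > 0" | "diameter U = 0" "s = 0" | "diameter U = 0" "s > 0"
      using d0 s by linarith
    then have "emeasure M (\<psi> -` cball x (diameter U) \<inter> S) \<le> ennreal C * diam_pow s U"
    proof cases
      case 1
      with ball[OF 1 U(2), of x] False C show ?thesis
        by (auto simp: diam_pow_def ennreal_mult)
    next
      case 2
      have "emeasure M (\<psi> -` cball x (diameter U) \<inter> S) \<le> emeasure M (\<psi> -` cball x \<rho> \<inter> S)"
        using 2 \<rho> by (intro emeasure_mono meas) auto
      also have "\<dots> \<le> ennreal (C * \<rho> powr s)" using ball[of \<rho> x] \<rho> by simp
      finally show ?thesis using 2 False \<rho> by (simp add: diam_pow_def)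
    next
      case 3
      have "((\<lambda>r. C * r powr s) \<longlongrightarrow> C * 0 powr s) (at_right 0)"
        using 3 by (intro tendsto_intros tendsto_powr2) (auto intro!: eventually_at_rightI[of 0 1])
      then have lim: "((\<lambda>r. ennreal (C * r powr s)) \<longlongrightarrow> ennreal 0) (at_right 0)"
        using 3 by (intro tendsto_ennrealI) simp
      have "emeasure M (\<psi> -` cball x (diameter U) \<inter> S) \<le> ennreal 0"
      proof (rule tendsto_lowerbound[OF lim])
        show "\<forall>\<^sub>F r in at_right 0. emeasure M (\<psi> -` cball x (diameter U) \<inter> S) \<le> ennreal (C * r powr s)"
          using eventually_at_right_real[OF \<rho>]
        proof eventually_elim
          case (elim r)
          have "emeasure M (\<psi> -` cball x (diameter U) \<inter> S) \<le> emeasure M (\<psi> -` cball x r \<inter> S)"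
            using 3 elim by (intro emeasure_mono meas) auto
          also have "\<dots> \<le> ennreal (C * r powr s)" using elim by (intro ball) auto
          finally show ?case .
        qed
      qed simp
      then show ?thesis by simp
    qed
    then show ?thesis using sub meas by (intro bexI[of _ "\<psi> -` cball x (diameter U) \<inter> S"]) auto
  qed
  have *: "emeasure M S / ennreal C \<le> (\<Sum>i. diam_pow s (U i))" if "delta_cover \<rho> E U" for U
  proof -
    have "\<forall>i. \<exists>B\<in>sets M. \<psi> -` U i \<inter> S \<subseteq> B \<and> emeasure M B \<le> ennreal C * diam_pow s (U i)"
      using that U by (auto simp: delta_cover_def)
    then obtain B where B: "\<And>i. B i \<in> sets M" "\<And>i. \<psi> -` U i \<inter> S \<subseteq> B i"
      "\<And>i. emeasure M (B i) \<le> ennreal C * diam_pow s (U i)" by metis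
    have "S \<subseteq> (\<Union>i. B i)"
    proof
      fix t assume t: "t \<in> S"
      then have "\<psi> t \<in> (\<Union>i. U i)" using E that unfolding delta_cover_def by blast
      then show "t \<in> (\<Union>i. B i)" using B(2) t by blast
    qed
    then have "emeasure M S \<le> emeasure M (\<Union>i. B i)"
      using B(1) by (intro emeasure_mono) auto
    also have "\<dots> \<le> (\<Sum>i. emeasure M (B i))"
      using B(1) by (intro emeasure_subadditive_countably) auto
    also have "\<dots> \<le> (\<Sum>i. ennreal C * diam_pow s (U i))"
      using B(3) by (intro suminf_le) auto
    also have "\<dots> = (\<Sum>i. diam_pow s (U i)) * ennreal C" by (simp add: mult.commute)
    finally have "emeasure M S / ennreal C \<le> (\<Sum>i. diam_pow s (U i)) * ennreal C / ennreal C"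
      by (rule divide_right_mono_ennreal)
    then show ?thesis using C by (simp add: ennreal_mult_divide_eq)
  qed
  have "0 < emeasure M S / ennreal C"
    using S(2) C by (simp add: ennreal_zero_less_divide)
  also have "\<dots> \<le> hausdorff_premeasure s \<rho> E"
    unfolding hausdorff_premeasure_def using * by (intro INF_greatest) auto
  also have "\<dots> \<le> hausdorff_measure s E"
    unfolding hausdorff_measure_def using \<rho> by (intro SUP_upper) simp
  finally show ?thesis .
qed

lemma hausdorff_measure_mono: "E \<subseteq> F \<Longrightarrow> hausdorff_measure s E \<le> hausdorff_measure s F"
  unfolding hausdorff_measure_def hausdorff_premeasure_def
  by (intro SUP_mono' INF_superset_mono) (fastforce simp: delta_cover_def)+

section \<open>Upper bound for the dimension\<close>

text \<open>The ratio of consecutive \<open>p\<close>-th powers tends to 1, so going back from a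
  large sum of length \<open>N\<close> to the preceding power \<open>k ^ p\<close> removes at most
  \<open>c / 2 * k ^ p\<close> terms, each of modulus 1.\<close>

lemma large_sum_set_frequently_on_powers:
  assumes p: "p > 0" and c: "c > 0" and x: "x \<in> large_sum_set f c"
  shows "\<exists>k\<ge>m. norm (V f x (k ^ p)) \<ge> c / 2 * real (k ^ p)"
proof -
  have "(\<lambda>k. (1 + 1 / real k) ^ p) \<longlonglongrightarrow> (1 + 0) ^ p"
    by (intro tendsto_intros lim_1_over_n)
  then have "\<forall>\<^sub>F k in sequentially. (1 + 1 / real k) ^ p < 1 + c / 2"
    using c by (intro order_tendstoD(2)) auto
  then obtain k0 where k0: "\<And>k. k \<ge> k0 \<Longrightarrow> (1 + 1 / real k) ^ p < 1 + c / 2"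
    by (auto simp: eventually_sequentially)
  define k1 where "k1 = Suc (max m k0)"
  have "infinite {N. 1 \<le> N \<and> norm (V f x N) \<ge> c * real N}"
    using x by (simp add: large_sum_set_def)
  then obtain N where N: "N \<ge> k1 ^ p" "norm (V f x N) \<ge> c * real N"
    unfolding infinite_nat_iff_unbounded_le by auto
  have ex: "N < Suc N ^ p"
    using p self_le_power[of "Suc N" p] by simp
  define l where "l = (LEAST l. N < l ^ p)"
  have l: "N < l ^ p" unfolding l_def using ex by (rule LeastI)
  then obtain k where k: "l = Suc k" using p by (cases l) (auto simp: zero_power)
  have "k ^ p \<le> N" using not_less_Least[of k "\<lambda>l. N < l ^ p"] k by (simp add: l_def)
  have "k1 ^ p < Suc k ^ p" using N(1) l k by simp
  then have "k1 < Suc k" by (rule power_less_imp_less_base) simp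
  then have kk: "k \<ge> m" "k \<ge> k0" "k > 0" by (auto simp: k1_def)
  have "real N \<le> real (Suc k ^ p)" using l k by (simp only: of_nat_le_iff)
  also have "\<dots> = real (k ^ p) * (1 + 1 / real k) ^ p"
    using kk by (simp add: field_simps flip: power_mult_distrib)
  also have "\<dots> \<le> real (k ^ p) * (1 + c / 2)"
    using k0[OF kk(2)] by (intro mult_left_mono) auto
  finally have N2: "real N - real (k ^ p) \<le> c / 2 * real (k ^ p)" by (simp add: algebra_simps)
  have "c * real (k ^ p) \<le> c * real N" using c \<open>k ^ p \<le> N\<close> by (intro mult_left_mono) auto
  moreover have "norm (V f x N - V f x (k ^ p)) \<le> real N - real (k ^ p)"
    using norm_V_diff_le[OF \<open>k ^ p \<le> N\<close>, of f x] \<open>k ^ p \<le> N\<close> by (simp add: of_nat_diff)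
  ultimately have "norm (V f x (k ^ p)) \<ge> c / 2 * real (k ^ p)"
    using norm_triangle_ineq2[of "V f x N" "V f x (k ^ p)"] N(2) N2 by linarith
  with kk show ?thesis by blast
qed

text \<open>
  The \<open>O(N powr (\<tau> - 1))\<close> intervals of length about \<open>N powr (- \<tau>)\<close> that carry large sums have
  \<open>s\<close>-volume at most a negative power of \<open>N\<close>; passing to \<open>N = k ^ p\<close> makes the series over \<open>k\<close> converge.
\<close>

lemma hausdorff_measure_large_sum_set_eq_0:
  fixes f :: "nat \<Rightarrow> nat"
  assumes \<tau>: "\<tau> \<ge> 1" and c: "c > 0" and inj: "inj_on f {1..}"
    and f: "\<And>n. n \<ge> 1 \<Longrightarrow> real (f n) \<le> K * real n powr \<tau>"
    and s: "1 - 1 / \<tau> < s" "s < 1"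
  shows "hausdorff_measure s (large_sum_set (\<lambda>n. real (f n)) c) = 0"
proof -
  define c' where "c' = c / 2"
  have c': "c' > 0" using c by (simp add: c'_def)
  have K: "K \<ge> 0" using f[of 1] by (simp add: order_trans[OF of_nat_0_le_iff])
  \<comment> \<open>\<open>L \<ge> 1\<close> gives \<open>R N \<ge> N\<close> and absorbs the
    ceiling into a factor 2, \<open>L > K\<close> puts the frequencies below \<open>R N\<close>, and
    the last summand secures the condition on \<open>B\<close> in
    \<open>large_sums_cover\<close>.\<close>
  define L where "L = 1 + K + 4 * pi * K / c'"
  have L: "L \<ge> 1" "L > K" "4 * pi * K \<le> c' * L"
    using K c' by (auto simp: L_def field_simps add_pos_nonneg)
  define R where "R N = nat \<lceil>L * real N powr \<tau>\<rceil>" for N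
  have R: "L * real N powr \<tau> \<le> real (R N)" "real (R N) \<le> 2 * L * real N powr \<tau>" "real N \<le> real (R N)"
    if N: "N \<ge> 1" for N
  proof -
    have "real N powr 1 \<le> real N powr \<tau>" using N \<tau> by (intro powr_mono) auto
    then have 1: "real N \<le> real N powr \<tau>" using N by simp
    have "1 * real N powr \<tau> \<le> L * real N powr \<tau>" using L by (intro mult_right_mono) auto
    then have 2: "real N \<le> L * real N powr \<tau>" using 1 by linarith
    have N1: "real N \<ge> 1" using N by simp
    have 3: "real (R N) = of_int \<lceil>L * real N powr \<tau>\<rceil>"
      unfolding R_def using 2 N1 by (intro of_nat_nat) linarith
    show "L * real N powr \<tau> \<le> real (R N)" "real (R N) \<le> 2 * L * real N powr \<tau>" "real N \<le> real (R N)"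
      using 2 N1 unfolding 3 by linarith+
  qed
  define I where "I N = {i. i < R N \<and> norm (V (\<lambda>n. real (f n)) (real i / real (R N)) N) \<ge> c' / 2 * real N}" for N
  have fin: "finite (I N)" for N by (simp add: I_def)
  have fN: "real (f n) \<le> K * real N powr \<tau>" if "n \<in> {1..N}" for n N
  proof -
    have "real (f n) \<le> K * real n powr \<tau>" using f that by simp
    also have "\<dots> \<le> K * real N powr \<tau>" using K that \<tau> by (intro mult_left_mono powr_mono2) auto
    finally show ?thesis .
  qed
  have cover: "{x \<in> {0..1}. norm (V (\<lambda>n. real (f n)) x N) \<ge> c' * real N}
           \<subseteq> (\<Union>i\<in>I N. {real i / real (R N) .. real (Suc i) / real (R N)})"
    and card: "real (card (I N)) \<le> 4 * real (R N) / (c'\<^sup>2 * real N)" if N: "N \<ge> 1" for N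
  proof -
    have "R N > 0" using R(3)[OF N] N by linarith
    have less: "f n < R N" if "n \<in> {1..N}" for n
    proof -
      have "K * real N powr \<tau> < L * real N powr \<tau>" using L N by (intro mult_strict_right_mono) auto
      then show ?thesis using fN[OF that] R(1)[OF N] by linarith
    qed
    have "4 * pi * (K * real N powr \<tau>) \<le> c' * L * real N powr \<tau>"
      using mult_right_mono[OF L(3), of "real N powr \<tau>"] by (simp add: mult_ac)
    also have "\<dots> \<le> c' * real (R N)" using mult_left_mono[OF R(1)[OF N], of c'] c' by (simp add: mult_ac)
    finally have B: "4 * pi * (K * real N powr \<tau>) \<le> c' * real (R N)" .
    have inj': "inj_on f {1..N}" using inj by (rule inj_on_subset) auto
    note * = large_sums_cover[OF \<open>R N > 0\<close> _ c' inj' less fN B]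
    show "{x \<in> {0..1}. norm (V (\<lambda>n. real (f n)) x N) \<ge> c' * real N}
           \<subseteq> (\<Union>i\<in>I N. {real i / real (R N) .. real (Suc i) / real (R N)})"
      "real (card (I N)) \<le> 4 * real (R N) / (c'\<^sup>2 * real N)"
      unfolding I_def using * N by auto
  qed
  \<comment> \<open>At most order \<open>N powr (\<tau> - 1)\<close> intervals, each of
    \<open>s\<close>-volume of order \<open>N powr (- \<tau> * s)\<close>, give total order
    \<open>N powr (- \<theta>)\<close>. The exponent \<open>p\<close> is then chosen with
    \<open>p * \<theta> > 1\<close>.\<close>
  define \<theta> where "\<theta> = 1 - \<tau> * (1 - s)"
  have \<theta>: "\<theta> > 0" using s \<tau> by (simp add: \<theta>_def field_simps)
  define p where "p = Suc (nat \<lceil>1 / \<theta>\<rceil>)"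
  have "1 / \<theta> < real p" unfolding p_def by linarith
  then have p: "p > 0" "real p * \<theta> > 1" using \<theta> by (auto simp: p_def field_simps)
  define C where "C = 4 / c'\<^sup>2 * (2 * L) powr (1 - s)"
  define a where "a k = C * real k powr (- (real p * \<theta>))" for k
  have C: "C \<ge> 0" by (simp add: C_def)
  have vol: "real (card (I (k ^ p))) * (1 / real (R (k ^ p))) powr s \<le> a k" if k: "k \<ge> 1" for k
  proof -
    define N where "N = k ^ p"
    have N: "N \<ge> 1" using k by (simp add: N_def)
    have N0: "real N > 0" and R0: "real (R N) > 0" using N R(3)[OF N] by linarith+
    have "real (card (I N)) * (1 / real (R N)) powr s \<le> 4 * real (R N) / (c'\<^sup>2 * real N) * (1 / real (R N)) powr s"
      by (intro mult_right_mono card N) auto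
    also have "\<dots> = 4 / c'\<^sup>2 * (real (R N) powr (1 - s) / real N)"
      using R0 by (simp add: powr_diff powr_divide)
    also have "\<dots> \<le> 4 / c'\<^sup>2 * ((2 * L * real N powr \<tau>) powr (1 - s) / real N)"
      using s R(2)[OF N] by (intro mult_left_mono divide_right_mono powr_mono2) auto
    also have "\<dots> = C * (real N powr (\<tau> * (1 - s)) / real N)"
      using L by (simp add: C_def powr_mult powr_powr)
    also have "\<dots> = C * real N powr (- \<theta>)"
      using N0 by (simp add: \<theta>_def powr_diff)
    also have "real N powr (- \<theta>) = real k powr (- (real p * \<theta>))"
      using k by (simp add: N_def powr_powr flip: powr_realpow)
    finally show ?thesis by (simp add: a_def N_def)
  qed
  have summ: "summable a"
    unfolding a_def using p by (intro summable_mult) (simp add: summable_real_powr_iff)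
  have a0: "a k \<ge> 0" for k using C by (simp add: a_def)
  have "hausdorff_premeasure s \<delta> (large_sum_set (\<lambda>n. real (f n)) c) = 0" if \<delta>: "\<delta> > 0" for \<delta>
  proof -
    have "hausdorff_premeasure s \<delta> (large_sum_set (\<lambda>n. real (f n)) c) \<le> 0 + ennreal e" if e: "e > 0" for e
    proof -
      obtain n0 where n0: "\<And>n. n \<ge> n0 \<Longrightarrow> norm (\<Sum>i. a (i + n)) < e"
        using suminf_exist_split[OF e summ] by blast
      \<comment> \<open>Starting at \<open>k = m\<close> makes the tail of the series smaller than
        \<open>e\<close> and the intervals no longer than \<open>\<delta>\<close>;
        \<open>Suc\<close> keeps \<open>k\<close> positive.\<close>
      define m where "m = Suc (n0 + nat \<lceil>1 / \<delta>\<rceil>)"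
      define U where "U k i = (if i \<in> I ((k + m) ^ p)
        then {real i / real (R ((k + m) ^ p)) .. real (Suc i) / real (R ((k + m) ^ p))} else {})" for k i
      have Rm: "1 / real (R ((k + m) ^ p)) \<le> \<delta>" "R ((k + m) ^ p) > 0" for k
      proof -
        have "real (k + m) \<le> real ((k + m) ^ p)"
          using p self_le_power[of "k + m" p] by (simp add: m_def del: of_nat_power)
        also have "\<dots> \<le> real (R ((k + m) ^ p))" by (rule R(3)) (simp add: m_def)
        finally have *: "real (k + m) \<le> real (R ((k + m) ^ p))" .
        show "R ((k + m) ^ p) > 0" using * by (simp add: m_def)
        have "1 / \<delta> \<le> real (k + m)" unfolding m_def by linarith
        then have "1 / \<delta> \<le> real (R ((k + m) ^ p))" using * by linarith
        then show "1 / real (R ((k + m) ^ p)) \<le> \<delta>"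
          using \<delta> \<open>R ((k + m) ^ p) > 0\<close> by (simp add: field_simps)
      qed
      have len: "real (Suc i) / real (R N) - real i / real (R N) = 1 / real (R N)" for i N
        by (simp add: diff_divide_distrib[symmetric])
      have "large_sum_set (\<lambda>n. real (f n)) c \<subseteq> (\<Union>k i. U k i)"
      proof
        fix x assume x: "x \<in> large_sum_set (\<lambda>n. real (f n)) c"
        obtain k where k: "k \<ge> m" "norm (V (\<lambda>n. real (f n)) x (k ^ p)) \<ge> c / 2 * real (k ^ p)"
          using large_sum_set_frequently_on_powers[OF p(1) c x] by blast
        have "k ^ p \<ge> 1" using k by (simp add: m_def)
        moreover have "x \<in> {0..1}" using x by (simp add: large_sum_set_def)
        ultimately obtain i where "i \<in> I (k ^ p)" "x \<in> {real i / real (R (k ^ p)) .. real (Suc i) / real (R (k ^ p))}"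
          using cover[of "k ^ p"] k(2) by (auto simp: c'_def subset_iff)
        then have "x \<in> U (k - m) i" using k by (simp add: U_def)
        then show "x \<in> (\<Union>k i. U k i)" by blast
      qed
      moreover have "bounded (U k i)" for k i by (simp add: U_def)
      moreover have "diameter (U k i) \<le> \<delta>" for k i
        using Rm[of k] \<delta> by (auto simp: U_def len simp del: of_nat_Suc)
      ultimately have "hausdorff_premeasure s \<delta> (large_sum_set (\<lambda>n. real (f n)) c)
          \<le> (\<Sum>k. \<Sum>i. diam_pow s (U k i))"
        by (rule hausdorff_premeasure_le_double_suminf)
      also have "\<dots> \<le> (\<Sum>k. ennreal (a (k + m)))"
      proof (rule suminf_le)
        fix k
        define N where "N = (k + m) ^ p"
        have s0: "s \<noteq> 0" using s \<tau> by (auto simp: field_simps)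
        have "(\<Sum>i. diam_pow s (U k i)) = (\<Sum>i\<in>I N. diam_pow s (U k i))"
          by (intro suminf_finite fin) (auto simp: U_def N_def diam_pow_def)
        also have "\<dots> = (\<Sum>i\<in>I N. ennreal ((1 / real (R N)) powr s))"
        proof (rule sum.cong[OF refl])
          fix i assume "i \<in> I N"
          then have Ui: "U k i = {real i / real (R N) .. real (Suc i) / real (R N)}" by (simp add: U_def N_def)
          have le: "real i / real (R N) \<le> real (Suc i) / real (R N)" by (simp add: divide_right_mono)
          then have "diameter (U k i) = 1 / real (R N)" "U k i \<noteq> {}"
            unfolding Ui using len[of i N] by auto
          then show "diam_pow s (U k i) = ennreal ((1 / real (R N)) powr s)"
            using s0 by (simp add: diam_pow_def)
        qed
        also have "\<dots> = ennreal (real (card (I N)) * (1 / real (R N)) powr s)"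
          by (simp add: ennreal_mult ennreal_of_nat_eq_real_of_nat)
        also have "\<dots> \<le> ennreal (a (k + m))"
          unfolding N_def by (intro ennreal_leI vol) (simp add: m_def)
        finally show "(\<Sum>i. diam_pow s (U k i)) \<le> ennreal (a (k + m))" .
      qed auto
      also have "\<dots> = ennreal (\<Sum>k. a (k + m))"
        using summ a0 by (intro suminf_ennreal2) (auto simp: summable_iff_shift)
      also have "\<dots> \<le> ennreal e" using n0[of m] by (intro ennreal_leI) (simp add: m_def)
      finally show ?thesis by simp
    qed
    then have "hausdorff_premeasure s \<delta> (large_sum_set (\<lambda>n. real (f n)) c) \<le> 0"
      by (rule ennreal_le_epsilon)
    then show ?thesis by simp
  qed
  then show ?thesis by (simp add: hausdorff_measure_def)
qed

subsection \<open>Spreading binary digits\<close>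

text \<open>
  \<open>spread Z t\<close> has the binary digits of \<open>t\<close> written, in order, at the positions outside \<open>Z\<close>, and
  zeros at the positions in \<open>Z\<close>; position \<open>n\<close> is the digit of weight \<open>2 ^ -(n + 1)\<close>.
  \<open>spread_prefix Z n t\<close> is the integer formed by the first \<open>n\<close> digits.
\<close>

definition free_count :: "nat set \<Rightarrow> nat \<Rightarrow> nat" where
  "free_count Z n = card ({..<n} - Z)"

definition spread_digit :: "nat set \<Rightarrow> nat \<Rightarrow> real \<Rightarrow> int" where
  "spread_digit Z n t = (if n \<in> Z then 0 else \<lfloor>2 ^ Suc (free_count Z n) * t\<rfloor> mod 2)"

primrec spread_prefix :: "nat set \<Rightarrow> nat \<Rightarrow> real \<Rightarrow> int" where
  "spread_prefix Z 0 t = 0"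
| "spread_prefix Z (Suc n) t = 2 * spread_prefix Z n t + spread_digit Z n t"

definition spread :: "nat set \<Rightarrow> real \<Rightarrow> real" where
  "spread Z t = (\<Sum>n. of_int (spread_digit Z n t) / 2 ^ Suc n)"

lemma free_count_Suc: "free_count Z (Suc n) = (if n \<in> Z then free_count Z n else Suc (free_count Z n))"
proof -
  have "{..<Suc n} - Z = (if n \<in> Z then {..<n} - Z else insert n ({..<n} - Z))"
    by (auto simp: less_Suc_eq)
  then show ?thesis by (simp add: free_count_def)
qed

lemma free_count_add_card: "free_count Z n + card (Z \<inter> {..<n}) = n"
proof -
  have "card ({..<n} - Z) + card (Z \<inter> {..<n}) = card (({..<n} - Z) \<union> (Z \<inter> {..<n}))"
    by (rule card_Un_disjoint[symmetric]) auto
  also have "({..<n} - Z) \<union> (Z \<inter> {..<n}) = {..<n}" by blast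
  finally show ?thesis by (simp add: free_count_def)
qed

lemma spread_digit_bounds: "0 \<le> spread_digit Z n t" "spread_digit Z n t \<le> 1"
proof -
  have "\<lfloor>2 ^ Suc (free_count Z n) * t\<rfloor> mod 2 < 2" by (rule pos_mod_bound) simp
  then show "spread_digit Z n t \<le> 1" by (auto simp: spread_digit_def)
qed (simp add: spread_digit_def)

lemma spread_prefix_LIMSEQ:
  "(\<lambda>n. of_int (spread_prefix Z n t) / 2 ^ n) \<longlonglongrightarrow> spread Z t"
proof -
  have "(\<Sum>i<n. of_int (spread_digit Z i t) / 2 ^ Suc i) = real_of_int (spread_prefix Z n t) / 2 ^ n" for n
    by (induction n) (auto simp: field_simps)
  moreover have "summable (\<lambda>n. real_of_int (spread_digit Z n t) / 2 ^ Suc n)"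
  proof (rule summable_comparison_test')
    show "summable (\<lambda>n. (1 / 2 :: real) ^ n)" by (rule summable_geometric) simp
    show "norm (real_of_int (spread_digit Z n t) / 2 ^ Suc n) \<le> (1 / 2) ^ n" for n
      using spread_digit_bounds[of Z n t] by (simp add: field_simps)
  qed
  ultimately show ?thesis
    using summable_LIMSEQ[of "\<lambda>n. real_of_int (spread_digit Z n t) / 2 ^ Suc n"]
    unfolding spread_def by simp
qed

lemma spread_prefix_le: "of_int (spread_prefix Z n t) \<le> 2 ^ n * spread Z t"
proof -
  have "incseq (\<lambda>n. real_of_int (spread_prefix Z n t) / 2 ^ n)"
    using spread_digit_bounds[of Z _ t] by (intro incseq_SucI) (simp add: field_simps)
  then have "of_int (spread_prefix Z n t) / 2 ^ n \<le> spread Z t"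
    using spread_prefix_LIMSEQ by (rule incseq_le)
  then show ?thesis by (simp add: field_simps)
qed

text \<open>Adding the largest possible tail \<open>(1 / 2) ^ n\<close> turns the increasing
  truncations into a decreasing sequence with the same limit.\<close>

lemma spread_le_prefix: "2 ^ n * spread Z t \<le> of_int (spread_prefix Z n t) + 1"
proof -
  have "real_of_int (spread_digit Z n t) \<le> 1" for n
    using spread_digit_bounds(2)[of Z n t] by simp
  then have "decseq (\<lambda>n. real_of_int (spread_prefix Z n t) / 2 ^ n + (1 / 2) ^ n)"
    by (intro decseq_SucI) (simp add: field_simps)
  moreover have "(\<lambda>n. real_of_int (spread_prefix Z n t) / 2 ^ n + (1 / 2) ^ n) \<longlonglongrightarrow> spread Z t + 0"
    by (intro tendsto_add spread_prefix_LIMSEQ LIMSEQ_power_zero) simp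
  ultimately have "spread Z t \<le> of_int (spread_prefix Z n t) / 2 ^ n + (1 / 2) ^ n"
    using decseq_ge by fastforce
  then show ?thesis by (simp add: field_simps)
qed

lemma borel_measurable_spread: "spread Z \<in> borel_measurable borel"
proof -
  have "(\<lambda>t. real_of_int (spread_digit Z n t)) \<in> borel_measurable borel" for n
    unfolding spread_digit_def by measurable
  then show ?thesis unfolding spread_def[abs_def] by measurable
qed

text \<open>Zero digits only shift the prefix, so \<open>2 ^ q * spread Z t\<close> exceeds an
  integer by at most \<open>1 / 2 ^ m\<close>. This supplies the hypothesis of
  \<open>V_block_seq_large\<close>.\<close>

lemma spread_zero_block:
  assumes "{q..<q + m} \<subseteq> Z"
  shows "2 ^ q * spread Z t \<le> of_int (spread_prefix Z q t) + 1 / 2 ^ m"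
proof -
  have "spread_prefix Z (q + l) t = 2 ^ l * spread_prefix Z q t" if "l \<le> m" for l
    using that
  proof (induction l)
    case (Suc l)
    then have "q + l \<in> Z" using assms by auto
    then show ?case using Suc by (simp add: spread_digit_def)
  qed simp
  then have "2 ^ (q + m) * spread Z t \<le> 2 ^ m * of_int (spread_prefix Z q t) + 1"
    using spread_le_prefix[of "q + m" Z t] by simp
  then show ?thesis by (simp add: field_simps power_add)
qed

text \<open>The digits of the prefix at free positions are the leading binary digits of
  \<open>t\<close>, so the prefix determines the dyadic interval containing
  \<open>t\<close>.\<close>

lemma floor_eq_if_spread_prefix_eq:
  assumes "spread_prefix Z n t = spread_prefix Z n u" and "t \<in> {0..<1}" "u \<in> {0..<1}"
  shows "\<lfloor>2 ^ free_count Z n * t\<rfloor> = \<lfloor>2 ^ free_count Z n * u\<rfloor>"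
  using assms(1)
proof (induction n)
  case 0
  have "\<lfloor>t\<rfloor> = 0" "\<lfloor>u\<rfloor> = 0" using assms(2,3) by (auto simp: floor_eq_iff)
  then show ?case by (simp add: free_count_def)
next
  case (Suc n)
  \<comment> \<open>The last digit is the parity of the prefix, so equal prefixes agree both in it
    and in what precedes it.\<close>
  have d: "spread_digit Z n t = spread_digit Z n u" and p: "spread_prefix Z n t = spread_prefix Z n u"
    using Suc.prems spread_digit_bounds[of Z n t] spread_digit_bounds[of Z n u] by simp_all presburger+
  note IH = Suc.IH[OF p]
  show ?case
  proof (cases "n \<in> Z")
    case True
    then show ?thesis using IH by (simp add: free_count_Suc)
  next
    case False
    have double: "\<lfloor>2 ^ Suc k * x\<rfloor> = 2 * \<lfloor>2 ^ k * x\<rfloor> + \<lfloor>2 ^ Suc k * x\<rfloor> mod 2" for k and x :: real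
    proof -
      have "\<lfloor>2 ^ Suc k * x\<rfloor> div 2 = \<lfloor>2 ^ k * x\<rfloor>"
        using floor_divide_real_eq_div[of 2 "2 ^ Suc k * x"] by simp
      then show ?thesis using mult_div_mod_eq[of 2 "\<lfloor>2 ^ Suc k * x\<rfloor>"] by simp
    qed
    have "\<lfloor>2 ^ Suc (free_count Z n) * t\<rfloor> = \<lfloor>2 ^ Suc (free_count Z n) * u\<rfloor>"
      using double[of "free_count Z n" t] double[of "free_count Z n" u] d False IH
      by (simp only: spread_digit_def if_False)
    then show ?thesis using False by (simp add: free_count_Suc)
  qed
qed

section \<open>Mass of balls and positivity of the measure of spread images\<close>

text \<open>Such a ball meets at most four prefixes of length \<open>n\<close>, and each of them
  confines \<open>t\<close> to one dyadic interval of length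
  \<open>1 / 2 ^ free_count Z n\<close>.\<close>

lemma emeasure_spread_ball_dyadic:
  assumes "r \<le> 1 / 2 ^ n"
  shows "emeasure lborel (spread Z -` cball x r \<inter> {0..<1}) \<le> ennreal (4 / 2 ^ free_count Z n)"
proof -
  define b where "b = free_count Z n"
  \<comment> \<open>The index of the dyadic interval forced by the prefix \<open>v\<close>; it is
    arbitrary when no \<open>t\<close> has this prefix.\<close>
  define \<kappa> where "\<kappa> v = (SOME k. \<exists>t\<in>{0..<1}. spread_prefix Z n t = v \<and> k = \<lfloor>2 ^ b * t\<rfloor>)" for v
  have \<kappa>: "\<kappa> (spread_prefix Z n t) = \<lfloor>2 ^ b * t\<rfloor>" if t: "t \<in> {0..<1}" for t
  proof -
    have "\<exists>k. \<exists>u\<in>{0..<1}. spread_prefix Z n u = spread_prefix Z n t \<and> k = \<lfloor>2 ^ b * u\<rfloor>"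
      using t by blast
    then have "\<exists>u\<in>{0..<1}. spread_prefix Z n u = spread_prefix Z n t \<and> \<kappa> (spread_prefix Z n t) = \<lfloor>2 ^ b * u\<rfloor>"
      unfolding \<kappa>_def by (rule someI_ex)
    then show ?thesis using floor_eq_if_spread_prefix_eq[of Z n _ t] t unfolding b_def by metis
  qed
  \<comment> \<open>The prefix is at most \<open>2 ^ n * spread Z t\<close> and at least that minus
    1, which in turn is within 1 of \<open>2 ^ n * x\<close>; a closed window of length 3 contains
    at most four integers.\<close>
  define J where "J = {\<lceil>2 ^ n * x - 2\<rceil>..\<lfloor>2 ^ n * x + 1\<rfloor>}"
  define A where "A v = {real_of_int (\<kappa> v) / 2 ^ b .. (of_int (\<kappa> v) + 1) / 2 ^ b}" for v
  have "spread Z -` cball x r \<inter> {0..<1} \<subseteq> (\<Union>v\<in>J. A v)"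
  proof
    fix t assume t: "t \<in> spread Z -` cball x r \<inter> {0..<1}"
    then have "\<bar>x - spread Z t\<bar> \<le> 1 / 2 ^ n" using assms by (simp add: dist_real_def)
    then have "2 ^ n * \<bar>x - spread Z t\<bar> \<le> 1" by (simp add: field_simps)
    then have "\<bar>2 ^ n * x - 2 ^ n * spread Z t\<bar> \<le> 1"
      by (simp add: abs_mult flip: right_diff_distrib)
    then have "spread_prefix Z n t \<in> J"
      using spread_prefix_le[of Z n t] spread_le_prefix[of n Z t]
      unfolding J_def by (simp add: ceiling_le_iff le_floor_iff) linarith
    moreover have "t \<in> A (spread_prefix Z n t)"
      using \<kappa>[of t] t floor_correct[of "2 ^ b * t"] by (simp add: A_def field_simps)
    ultimately show "t \<in> (\<Union>v\<in>J. A v)" by blast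
  qed
  then have "emeasure lborel (spread Z -` cball x r \<inter> {0..<1}) \<le> emeasure lborel (\<Union>v\<in>J. A v)"
    by (intro emeasure_mono) (auto simp: A_def J_def)
  also have "\<dots> \<le> (\<Sum>v\<in>J. emeasure lborel (A v))"
    by (intro emeasure_subadditive_finite) (auto simp: A_def J_def)
  also have "\<dots> = (\<Sum>v\<in>J. ennreal (1 / 2 ^ b))"
    by (intro sum.cong refl) (simp add: A_def divide_right_mono flip: diff_divide_distrib)
  also have "\<dots> = ennreal (real (card J) * (1 / 2 ^ b))"
    by (simp add: ennreal_of_nat_eq_real_of_nat flip: ennreal_mult)
  also have "\<dots> \<le> ennreal (4 / 2 ^ b)"
  proof (intro ennreal_leI)
    have "\<lfloor>2 ^ n * x + 1\<rfloor> - \<lceil>2 ^ n * x - 2\<rceil> + 1 \<le> 4" by linarith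
    then have "card J \<le> 4" unfolding J_def by (simp only: card_atLeastAtMost_int nat_le_iff)
    then have "real (card J) \<le> 4" by simp
    then show "real (card J) * (1 / 2 ^ b) \<le> 4 / 2 ^ b" by (simp add: divide_right_mono)
  qed
  finally show ?thesis unfolding b_def .
qed

text \<open>At least \<open>s * n - D\<close> of the first \<open>n\<close> positions are free, so a
  ball of radius about \<open>1 / 2 ^ n\<close> has mass of order at most its radius to the power
  \<open>s\<close>, as the mass distribution principle requires.\<close>

lemma hausdorff_measure_spread_pos:
  assumes s: "s \<ge> 0" and Z: "\<And>n. real (card (Z \<inter> {..<n})) \<le> (1 - s) * real n + D"
  shows "hausdorff_measure s (spread Z ` {0..<1}) > 0"
proof (rule hausdorff_measure_pos_if_ball_bound[where M = lborel and S = "{0..<1}" and \<psi> = "spread Z"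
      and \<rho> = 1 and C = "4 * 2 powr (D + s)"])
  show "0 < (4 * 2 powr (D + s) :: real)" by simp
  fix x r :: real assume r: "0 < r" "r \<le> 1"
  \<comment> \<open>The largest \<open>n\<close> with \<open>r \<le> 1 / 2 ^ n\<close>; the rounding
    costs a factor \<open>2 powr s\<close>, which accounts for the \<open>s\<close> in the constant
    \<open>2 powr (D + s)\<close>.\<close>
  define n where "n = nat \<lfloor>- log 2 r\<rfloor>"
  have "- log 2 r \<ge> 0" using r by simp
  then have n: "real n \<le> - log 2 r" "- log 2 r < real n + 1"
    unfolding n_def by (auto simp: of_nat_nat)
  have "r = 2 powr (log 2 r)" using r by simp
  also have "\<dots> \<le> 2 powr (- real n)" using n by (intro powr_mono) auto
  also have "\<dots> = 1 / 2 ^ n" by (simp add: powr_minus_divide powr_realpow)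
  finally have "emeasure lborel (spread Z -` cball x r \<inter> {0..<1}) \<le> ennreal (4 / 2 ^ free_count Z n)"
    by (rule emeasure_spread_ball_dyadic)
  also have "\<dots> \<le> ennreal (4 * 2 powr (D + s) * r powr s)"
  proof (rule ennreal_leI)
    have "real (free_count Z n) + real (card (Z \<inter> {..<n})) = real n"
      using free_count_add_card[of Z n] by linarith
    then have c: "s * real n - D \<le> real (free_count Z n)" using Z[of n] by (simp add: algebra_simps)
    have "s * (- log 2 r) \<le> s * (real n + 1)" using n s by (intro mult_left_mono) auto
    then have e: "- real (free_count Z n) \<le> (D + s) + s * log 2 r" using c by (simp add: algebra_simps)
    have "1 / 2 ^ free_count Z n = 2 powr (- real (free_count Z n))"
      by (simp add: powr_minus_divide powr_realpow)
    also have "\<dots> \<le> 2 powr ((D + s) + s * log 2 r)" using e by (intro powr_mono) auto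
    also have "\<dots> = 2 powr (D + s) * (2 powr log 2 r) powr s"
      by (simp add: powr_add powr_powr mult.commute)
    also have "2 powr log 2 r = r" using r by simp
    finally show "4 / 2 ^ free_count Z n \<le> 4 * 2 powr (D + s) * r powr s" by simp
  qed
  finally show "emeasure lborel (spread Z -` cball x r \<inter> {0..<1}) \<le> ennreal (4 * 2 powr (D + s) * r powr s)" .
qed (use s borel_measurable_spread in auto)

subsection \<open>The block sequence\<close>

text \<open>For \<open>n\<close> between \<open>4 ^ j\<close> and \<open>4 ^ (j + 1)\<close>, two to
  this exponent is \<open>n powr (\<tau> - 1)\<close> up to a constant factor, the most that growth
  \<open>n powr \<tau>\<close> permits.\<close>

definition block_exponent :: "real \<Rightarrow> nat \<Rightarrow> nat" where
  "block_exponent \<tau> j = nat \<lfloor>2 * (\<tau> - 1) * real j\<rfloor>"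

definition block_seq :: "real \<Rightarrow> nat \<Rightarrow> nat" where
  "block_seq \<tau> n = n * 2 ^ block_exponent \<tau> (nat \<lfloor>log 4 (real n)\<rfloor>)"

lemma block_exponent_bounds:
  assumes "\<tau> \<ge> 1"
  shows "real (block_exponent \<tau> j) \<le> 2 * (\<tau> - 1) * real j"
    and "2 * (\<tau> - 1) * real j < real (block_exponent \<tau> j) + 1"
proof -
  have "0 \<le> 2 * (\<tau> - 1) * real j" using assms by simp
  then show "real (block_exponent \<tau> j) \<le> 2 * (\<tau> - 1) * real j"
    "2 * (\<tau> - 1) * real j < real (block_exponent \<tau> j) + 1"
    unfolding block_exponent_def by linarith+
qed

lemma block_exponent_mono:
  assumes "\<tau> \<ge> 1" "i \<le> j"
  shows "block_exponent \<tau> i \<le> block_exponent \<tau> j"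
  unfolding block_exponent_def using assms by (intro nat_mono floor_mono mult_left_mono) auto

lemma block_seq_eq:
  assumes "n \<in> {4 ^ j..<4 ^ Suc j}"
  shows "block_seq \<tau> n = n * 2 ^ block_exponent \<tau> j"
proof -
  have "(0::nat) < 4 ^ j" by simp
  then have "n > 0" using assms by (auto simp del: zero_less_power)
  then have "\<lfloor>log 4 (real n)\<rfloor> = int j"
    using assms floor_log_nat_eq_powr_iff[of 4 n j] by simp
  then show ?thesis by (simp add: block_seq_def)
qed

lemma strict_mono_on_block_seq:
  assumes "\<tau> \<ge> 1"
  shows "strict_mono_on {1..} (block_seq \<tau>)"
proof (rule strict_mono_onI)
  fix m n :: nat assume mn: "m \<in> {1..}" "m < n"
  then have "log 4 (real m) \<le> log 4 (real n)" by simp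
  then have "block_exponent \<tau> (nat \<lfloor>log 4 (real m)\<rfloor>) \<le> block_exponent \<tau> (nat \<lfloor>log 4 (real n)\<rfloor>)"
    using assms by (intro block_exponent_mono nat_mono floor_mono)
  then have "(2::nat) ^ block_exponent \<tau> (nat \<lfloor>log 4 (real m)\<rfloor>) \<le> 2 ^ block_exponent \<tau> (nat \<lfloor>log 4 (real n)\<rfloor>)"
    by (intro power_increasing) auto
  then show "block_seq \<tau> m < block_seq \<tau> n"
    unfolding block_seq_def using mn(2) by (intro mult_less_le_imp_less) auto
qed

lemma block_seq_le_powr:
  assumes \<tau>: "\<tau> \<ge> 1" and n: "n \<ge> 1"
  shows "real (block_seq \<tau> n) \<le> real n powr \<tau>"
proof -
  define j where "j = nat \<lfloor>log 4 (real n)\<rfloor>"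
  have "log 4 (real n) \<ge> 0" using n by simp
  then have j: "real j \<le> log 4 (real n)" unfolding j_def by linarith
  have "real (2 ^ block_exponent \<tau> j) = 2 powr real (block_exponent \<tau> j)"
    by (simp add: powr_realpow)
  also have "\<dots> \<le> 2 powr (2 * (\<tau> - 1) * real j)"
    using block_exponent_bounds(1)[OF \<tau>] by (intro powr_mono) auto
  also have "\<dots> \<le> 2 powr (2 * (\<tau> - 1) * log 4 (real n))"
    using j \<tau> by (intro powr_mono mult_left_mono) auto
  also have "\<dots> = ((2 powr 2) powr log 4 (real n)) powr (\<tau> - 1)"
    by (simp only: powr_powr mult_ac)
  also have "\<dots> = real n powr (\<tau> - 1)" using n by simp
  finally have "real n * real (2 ^ block_exponent \<tau> j) \<le> real n * real n powr (\<tau> - 1)"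
    by (intro mult_left_mono) auto
  also have "\<dots> = real n powr \<tau>" using n by (simp add: powr_diff)
  finally show ?thesis by (simp add: block_seq_def j_def)
qed

text \<open>
  On the last block before \<open>N = 4 ^ Suc j - 1\<close> all frequencies are multiples of \<open>2 ^ q\<close>; that block
  has three times as many terms as everything before it.
\<close>

lemma V_block_seq_large:
  fixes a :: int
  assumes x: "of_int a \<le> 2 ^ block_exponent \<tau> j * x"
      "2 ^ block_exponent \<tau> j * x \<le> of_int a + 1 / 2 ^ (2 * j + 5)"
  shows "norm (V (\<lambda>n. real (block_seq \<tau> n)) x (4 ^ Suc j - 1)) \<ge> 1 / 8 * real (4 ^ Suc j - 1)"
proof -
  define \<theta> where "\<theta> = 2 ^ block_exponent \<tau> j * x - of_int a"
  have \<theta>: "0 \<le> \<theta>" "\<theta> \<le> 1 / 2 ^ (2 * j + 5)" using x by (auto simp: \<theta>_def)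
  define h where "h n = cos (2 * pi * (x * real (block_seq \<tau> n)))" for n
  have h: "h n \<ge> 1 / 2" if n: "n \<in> {4 ^ j..<4 ^ Suc j}" for n
  proof -
    \<comment> \<open>The integer \<open>n * a\<close> contributes only full turns, leaving the
      angle \<open>2 * pi * n * \<theta>\<close>.\<close>
    have "x * real (block_seq \<tau> n) = of_int (int n * a) + real n * \<theta>"
      using block_seq_eq[OF n, of \<tau>] by (simp add: \<theta>_def algebra_simps)
    then have "2 * pi * (x * real (block_seq \<tau> n)) = 2 * pi * real n * \<theta> + of_int (int n * a) * (2 * pi)"
      by (simp add: algebra_simps)
    then have eq: "h n = cos (2 * pi * real n * \<theta>)"
      unfolding h_def using cos.plus_of_int[of "2 * pi * real n * \<theta>" "int n * a"]
      by (simp only: mult_ac of_real_eq_id id_apply)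
    \<comment> \<open>Of the \<open>2 * j + 5\<close> binary places, \<open>2 * j + 2\<close> are
      used up by the size of \<open>n\<close>; the other three leave an angle of at most
      \<open>pi / 4\<close>, below \<open>pi / 3\<close>.\<close>
    have "real n \<le> real (4 ^ Suc j)" using n unfolding of_nat_le_iff by simp
    also have "\<dots> = 2 ^ (2 * j + 2)" by (simp add: power_add power_mult)
    finally have "real n * \<theta> \<le> 2 ^ (2 * j + 2) * (1 / 2 ^ (2 * j + 5))"
      using \<theta> by (intro mult_mono) auto
    also have "\<dots> = 1 / 8" by (simp add: power_add)
    finally have "2 * pi * (real n * \<theta>) \<le> 2 * pi * (1 / 8)" by (intro mult_left_mono) auto
    then have "2 * pi * real n * \<theta> \<le> pi / 3" using pi_gt_zero unfolding mult.assoc by linarith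
    then have "cos (2 * pi * real n * \<theta>) \<ge> cos (pi / 3)"
      using \<theta> pi_gt_zero by (intro cos_monotone_0_pi_le) auto
    then show ?thesis using eq by (simp add: cos_60)
  qed
  \<comment> \<open>The first \<open>M - 1\<close> terms contribute at least \<open>1 - M\<close>
    and the \<open>3 * M\<close> terms of the block at least \<open>3 / 2 * M\<close>, so the real
    part is at least \<open>M / 2 + 1\<close>, which exceeds an eighth of
    \<open>4 * M - 1\<close>.\<close>
  define M :: nat where "M = 4 ^ j"
  have M: "4 ^ Suc j = 4 * M" "M \<ge> 1" by (simp_all add: M_def)
  have "Re (V (\<lambda>n. real (block_seq \<tau> n)) x (4 * M - 1)) = sum h {1..4 * M - 1}"
    unfolding V_def ee_of_real h_def by simp
  also have "{1..4 * M - 1} = {1..<M} \<union> {M..<4 * M}" using M(2) by auto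
  also have "sum h \<dots> = sum h {1..<M} + sum h {M..<4 * M}"
    by (intro sum.union_disjoint) auto
  finally have "Re (V (\<lambda>n. real (block_seq \<tau> n)) x (4 * M - 1)) = sum h {1..<M} + sum h {M..<4 * M}" .
  moreover have "(\<Sum>n\<in>{1..<M}. - 1) \<le> sum h {1..<M}"
    by (intro sum_mono) (simp add: h_def)
  then have "1 - real M \<le> sum h {1..<M}" using M(2) by (simp add: of_nat_diff)
  moreover have "(\<Sum>n\<in>{M..<4 * M}. 1 / 2) \<le> sum h {M..<4 * M}"
    using h M(1) by (intro sum_mono) (simp add: M_def)
  then have "3 / 2 * real M \<le> sum h {M..<4 * M}" by (simp add: of_nat_diff)
  moreover have "real (4 * M - 1) \<le> 4 * real M" by linarith
  ultimately show ?thesis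
    using complex_Re_le_cmod[of "V (\<lambda>n. real (block_seq \<tau> n)) x (4 * M - 1)"]
    unfolding M(1) by linarith
qed

section \<open>Blocks of vanishing digits and their density\<close>

text \<open>The length \<open>2 * j + 5\<close> matches the precision demanded by
  \<open>V_block_seq_large\<close>.\<close>

definition zero_block :: "real \<Rightarrow> nat \<Rightarrow> nat set" where
  "zero_block \<tau> j = {block_exponent \<tau> j..<block_exponent \<tau> j + (2 * j + 5)}"

text \<open>Each index \<open>j = A ^ Suc k\<close> yields a large sum of length
  \<open>4 ^ Suc j - 1\<close>, with the prefix before the zero block as the integer
  \<open>a\<close> of \<open>V_block_seq_large\<close>; these lengths are unbounded.\<close>

lemma spread_subset_large_sum_set:
  assumes A: "A \<ge> 2"
  shows "spread (\<Union>k. zero_block \<tau> (A ^ Suc k)) ` {0..<1} \<subseteq> large_sum_set (\<lambda>n. real (block_seq \<tau> n)) (1 / 8)"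
proof
  define Z where "Z = (\<Union>k. zero_block \<tau> (A ^ Suc k))"
  fix x assume "x \<in> spread (\<Union>k. zero_block \<tau> (A ^ Suc k)) ` {0..<1}"
  then obtain t where x: "x = spread Z t" by (auto simp: Z_def)
  have "x \<in> {0..1}"
    using spread_prefix_le[of Z 0 t] spread_le_prefix[of 0 Z t] by (simp add: x)
  moreover have "infinite {N. 1 \<le> N \<and> norm (V (\<lambda>n. real (block_seq \<tau> n)) x N) \<ge> 1 / 8 * real N}"
    unfolding infinite_nat_iff_unbounded_le
  proof
    fix m
    define j where "j = A ^ Suc m"
    have "Suc m < j" unfolding j_def using A by (intro power_gt_expt) simp
    moreover have "Suc j < 4 ^ Suc j" by (intro power_gt_expt) simp
    ultimately have "m \<le> 4 ^ Suc j - 1" "1 \<le> (4::nat) ^ Suc j - 1" by linarith+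
    moreover have "zero_block \<tau> j \<subseteq> Z" by (auto simp: Z_def j_def)
    then have "norm (V (\<lambda>n. real (block_seq \<tau> n)) x (4 ^ Suc j - 1)) \<ge> 1 / 8 * real (4 ^ Suc j - 1)"
      unfolding x zero_block_def
      by (intro V_block_seq_large[of "spread_prefix Z (block_exponent \<tau> j) t"] spread_prefix_le spread_zero_block)
    ultimately show "\<exists>n\<ge>m. n \<in> {N. 1 \<le> N \<and> norm (V (\<lambda>n. real (block_seq \<tau> n)) x N) \<ge> 1 / 8 * real N}"
      by blast
  qed
  ultimately show "x \<in> large_sum_set (\<lambda>n. real (block_seq \<tau> n)) (1 / 8)"
    by (simp add: large_sum_set_def)
qed

text \<open>The count is at most \<open>2 * j + 5\<close> and at most
  \<open>n - 2 * (\<tau> - 1) * j + 1\<close>. Adding \<open>\<tau> - 1\<close> times the first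
  bound to the second eliminates \<open>j\<close>. The extremal case is essentially \<open>n\<close>
  at the end of the block.\<close>

lemma card_zero_block_le:
  assumes \<tau>: "\<tau> \<ge> 1"
  shows "real (card (zero_block \<tau> j \<inter> {..<n})) \<le> real n / \<tau> + 5"
proof (cases "block_exponent \<tau> j \<le> n")
  case True
  define y where "y = card (zero_block \<tau> j \<inter> {..<n})"
  have "y \<le> card (zero_block \<tau> j)" unfolding y_def by (intro card_mono) (auto simp: zero_block_def)
  then have "real y \<le> 2 * real j + 5" by (simp add: zero_block_def)
  then have 1: "(\<tau> - 1) * real y \<le> (\<tau> - 1) * (2 * real j + 5)" using \<tau> by (intro mult_left_mono) auto
  have "y \<le> card {block_exponent \<tau> j..<n}" unfolding y_def by (intro card_mono) (auto simp: zero_block_def)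
  then have "real y \<le> real n - real (block_exponent \<tau> j)" using True by (simp add: of_nat_diff)
  then have "real y \<le> real n - 2 * (\<tau> - 1) * real j + 1"
    using block_exponent_bounds(2)[OF \<tau>, of j] by linarith
  with 1 have "\<tau> * real y \<le> 5 * (\<tau> - 1) + real n + 1" by (simp add: algebra_simps)
  then have "\<tau> * real y \<le> real n + 5 * \<tau>" using \<tau> by simp
  then show ?thesis using \<tau> by (simp add: y_def field_simps)
next
  case False
  then have "zero_block \<tau> j \<inter> {..<n} = {}" by (auto simp: zero_block_def)
  then show ?thesis using \<tau> by simp
qed

text \<open>Only the last block begun before \<open>n\<close> can fill a proportion near
  \<open>1 / \<tau>\<close>; a large ratio \<open>A\<close> makes all earlier blocks together
  negligible compared with \<open>n\<close>.\<close>

lemma zero_blocks_density: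
  assumes \<tau>: "\<tau> > 1" and s: "s < 1 - 1 / \<tau>"
  shows "\<exists>A\<ge>2. \<forall>n. real (card ((\<Union>k. zero_block \<tau> (A ^ Suc k)) \<inter> {..<n})) \<le> (1 - s) * real n + 5"
proof -
  define \<epsilon> where "\<epsilon> = 1 - s - 1 / \<tau>"
  have \<epsilon>: "\<epsilon> > 0" using s by (simp add: \<epsilon>_def)
  \<comment> \<open>The earlier blocks have at most \<open>14 * A ^ K\<close> positions while
    \<open>n\<close> is at least \<open>2 * (\<tau> - 1) * A ^ Suc K\<close>; the quotient
    \<open>7 / ((\<tau> - 1) * A)\<close> has to be at most the slack
    \<open>\<epsilon>\<close>.\<close>
  define A where "A = 2 + nat \<lceil>7 / ((\<tau> - 1) * \<epsilon>)\<rceil>"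
  have A2: "A \<ge> 2" by (simp add: A_def)
  have "7 / ((\<tau> - 1) * \<epsilon>) \<le> real A" unfolding A_def by linarith
  then have A: "7 \<le> \<epsilon> * ((\<tau> - 1) * real A)" using \<tau> \<epsilon> by (simp add: field_simps)
  define q where "q k = block_exponent \<tau> (A ^ Suc k)" for k
  have q: "2 * (\<tau> - 1) * real (A ^ Suc k) < real (q k) + 1" for k
    unfolding q_def using \<tau> by (intro block_exponent_bounds(2)) simp
  have q_mono: "q k \<le> q l" if "k \<le> l" for k l
    unfolding q_def using that A2 \<tau> by (intro block_exponent_mono power_increasing) auto
  have "real (card ((\<Union>k. zero_block \<tau> (A ^ Suc k)) \<inter> {..<n})) \<le> (1 - s) * real n + 5" for n
  proof -
    have "\<exists>l. n \<le> q l"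
    proof -
      obtain l where l: "(real n + 1) / (2 * (\<tau> - 1)) < real A ^ l"
        using real_arch_pow[of "real A"] A2 by auto
      have "real A ^ l \<le> real A ^ Suc l" using A2 by (intro power_increasing) auto
      then have "(real n + 1) / (2 * (\<tau> - 1)) < real (A ^ Suc l)" using l by simp
      then have "real n + 1 < 2 * (\<tau> - 1) * real (A ^ Suc l)" using \<tau> by (simp add: field_simps)
      then have "n \<le> q l" using q[of l] by linarith
      then show ?thesis ..
    qed
    \<comment> \<open>The first block starting at or after \<open>n\<close>: blocks from
      \<open>l\<close> on miss \<open>{..<n}\<close>, and if \<open>l = Suc K\<close>, block
      \<open>K\<close> is the last one begun before \<open>n\<close>.\<close>
    define l where "l = (LEAST l. n \<le> q l)"
    have l: "n \<le> q l" unfolding l_def using \<open>\<exists>l. n \<le> q l\<close> by (rule LeastI_ex)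
    have empty: "zero_block \<tau> (A ^ Suc k) \<inter> {..<n} = {}" if "l \<le> k" for k
      using q_mono[OF that] l by (auto simp: zero_block_def q_def)
    show ?thesis
    proof (cases l)
      case 0
      then have "(\<Union>k. zero_block \<tau> (A ^ Suc k)) \<inter> {..<n} = {}" using empty by blast
      moreover have "1 - s \<ge> 0" using s \<tau> by (smt (verit) divide_pos_pos)
      ultimately show ?thesis by simp
    next
      case (Suc K)
      then have "q K < n" using not_less_Least[of K "\<lambda>l. n \<le> q l"] by (simp add: l_def)
      then have "real (q K) + 1 \<le> real n" by linarith
      then have AK: "2 * (\<tau> - 1) * real (A ^ Suc K) \<le> real n" using q[of K] by linarith
      have sub: "(\<Union>k. zero_block \<tau> (A ^ Suc k)) \<inter> {..<n}
          \<subseteq> (\<Union>k<K. zero_block \<tau> (A ^ Suc k)) \<union> (zero_block \<tau> (A ^ Suc K) \<inter> {..<n})"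
      proof
        fix i assume i: "i \<in> (\<Union>k. zero_block \<tau> (A ^ Suc k)) \<inter> {..<n}"
        then obtain k where k: "i \<in> zero_block \<tau> (A ^ Suc k)" by blast
        then have "zero_block \<tau> (A ^ Suc k) \<inter> {..<n} \<noteq> {}" using i by blast
        then have "k < l" using empty[of k] by (meson not_less)
        then have "k < K \<or> k = K" using Suc by auto
        then show "i \<in> (\<Union>k<K. zero_block \<tau> (A ^ Suc k)) \<union> (zero_block \<tau> (A ^ Suc K) \<inter> {..<n})"
          using i k by blast
      qed
      have geom: "(\<Sum>k<K. A ^ Suc k) \<le> 2 * A ^ K"
      proof (induction K)
        case (Suc K)
        have "2 * A ^ K \<le> A * A ^ K" using A2 by (rule mult_le_mono1)
        then show ?case using Suc by (simp only: sum.lessThan_Suc power_Suc)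
      qed simp
      have "card (\<Union>k<K. zero_block \<tau> (A ^ Suc k)) \<le> (\<Sum>k<K. card (zero_block \<tau> (A ^ Suc k)))"
        by (rule card_UN_le) simp
      also have "\<dots> \<le> (\<Sum>k<K. 7 * A ^ Suc k)"
      proof (rule sum_mono)
        fix k
        have "1 \<le> A ^ Suc k" using A2 by (intro one_le_power) simp
        then show "card (zero_block \<tau> (A ^ Suc k)) \<le> 7 * A ^ Suc k" by (simp add: zero_block_def)
      qed
      also have "\<dots> = 7 * (\<Sum>k<K. A ^ Suc k)" by (simp only: sum_distrib_left)
      also have "\<dots> \<le> 7 * (2 * A ^ K)" using geom by (rule mult_le_mono2)
      finally have early: "card (\<Union>k<K. zero_block \<tau> (A ^ Suc k)) \<le> 14 * A ^ K" by simp
      have "card ((\<Union>k. zero_block \<tau> (A ^ Suc k)) \<inter> {..<n})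
          \<le> card ((\<Union>k<K. zero_block \<tau> (A ^ Suc k)) \<union> (zero_block \<tau> (A ^ Suc K) \<inter> {..<n}))"
        using sub by (intro card_mono) (auto simp: zero_block_def)
      also have "\<dots> \<le> card (\<Union>k<K. zero_block \<tau> (A ^ Suc k)) + card (zero_block \<tau> (A ^ Suc K) \<inter> {..<n})"
        by (rule card_Un_le)
      also have "\<dots> \<le> 14 * A ^ K + card (zero_block \<tau> (A ^ Suc K) \<inter> {..<n})"
        using early by (rule add_right_mono)
      finally have "real (card ((\<Union>k. zero_block \<tau> (A ^ Suc k)) \<inter> {..<n}))
          \<le> real (14 * A ^ K + card (zero_block \<tau> (A ^ Suc K) \<inter> {..<n}))"
        by (simp only: of_nat_le_iff)
      then have "real (card ((\<Union>k. zero_block \<tau> (A ^ Suc k)) \<inter> {..<n}))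
          \<le> 14 * real (A ^ K) + real (card (zero_block \<tau> (A ^ Suc K) \<inter> {..<n}))"
        by (simp only: of_nat_add of_nat_mult of_nat_numeral)
      moreover have "real (card (zero_block \<tau> (A ^ Suc K) \<inter> {..<n})) \<le> real n / \<tau> + 5"
        using \<tau> by (intro card_zero_block_le) simp
      moreover have "14 * real (A ^ K) \<le> \<epsilon> * real n"
      proof -
        have "7 * (2 * real (A ^ K)) \<le> \<epsilon> * ((\<tau> - 1) * real A) * (2 * real (A ^ K))"
          using A by (intro mult_right_mono) auto
        also have "\<dots> = \<epsilon> * (2 * (\<tau> - 1) * real (A ^ Suc K))" by simp
        also have "\<dots> \<le> \<epsilon> * real n" using AK \<epsilon> by (intro mult_left_mono) auto
        finally show ?thesis by simp
      qed
      ultimately show ?thesis by (simp add: \<epsilon>_def algebra_simps)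
    qed
  qed
  with A2 show ?thesis by blast
qed

theorem theorem3p8:
  fixes \<tau> :: real
  assumes "\<tau> \<ge> 1"
  shows "\<exists>(f :: nat \<Rightarrow> nat) (c :: real).
           (\<forall>n\<ge>1. f n \<ge> 1) \<and> strict_mono_on {1..} f \<and>
           (\<lambda>n. real (f n)) \<in> O(\<lambda>n. real n powr \<tau>) \<and>
           c > 0 \<and>
           hausdorff_dim (large_sum_set (\<lambda>n. real (f n)) c) = ereal (1 - 1 / \<tau>)"
proof (intro exI[of _ "block_seq \<tau>"] exI[of _ "1 / 8 :: real"] conjI)
  let ?G = "large_sum_set (\<lambda>n. real (block_seq \<tau> n)) (1 / 8)"
  show "\<forall>n\<ge>1. block_seq \<tau> n \<ge> 1" by (auto simp: block_seq_def)
  show mono: "strict_mono_on {1..} (block_seq \<tau>)" by (rule strict_mono_on_block_seq[OF assms])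
  have le: "real (block_seq \<tau> n) \<le> 1 * real n powr \<tau>" if "n \<ge> 1" for n
    using block_seq_le_powr[OF assms that] by simp
  then show "(\<lambda>n. real (block_seq \<tau> n)) \<in> O(\<lambda>n. real n powr \<tau>)"
    by (intro bigoI[of _ 1]) (auto intro!: eventually_sequentiallyI[of 1])
  show "(0::real) < 1 / 8" by simp
  have "0 \<le> 1 - 1 / \<tau>" "1 - 1 / \<tau> < 1" using assms by auto
  show "hausdorff_dim ?G = ereal (1 - 1 / \<tau>)"
  proof (rule antisym)
    \<comment> \<open>\<open>hausdorff_measure_large_sum_set_eq_0\<close> needs an exponent strictly
      between \<open>1 - 1 / \<tau>\<close> and 1, so the critical exponent is approached from
      above.\<close>
    show "hausdorff_dim ?G \<le> ereal (1 - 1 / \<tau>)"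
    proof (rule dense_ge_bounded)
      show "ereal (1 - 1 / \<tau>) < ereal 1" using \<open>1 - 1 / \<tau> < 1\<close> by simp
      fix w assume w: "ereal (1 - 1 / \<tau>) < w" "w < ereal 1"
      then obtain s where s: "w = ereal s" by (cases w) auto
      then have "hausdorff_measure s ?G = 0"
        using w hausdorff_measure_large_sum_set_eq_0[OF assms _ strict_mono_on_imp_inj_on[OF mono] le, of "1 / 8" s]
        by simp
      moreover have "0 \<le> s" using w s \<open>0 \<le> 1 - 1 / \<tau>\<close> by simp
      ultimately show "hausdorff_dim ?G \<le> w"
        unfolding hausdorff_dim_def s by (intro INF_lower) simp
    qed
    show "ereal (1 - 1 / \<tau>) \<le> hausdorff_dim ?G"
      unfolding hausdorff_dim_def
    proof (rule INF_greatest)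
      fix s assume "s \<in> {s. 0 \<le> s \<and> hausdorff_measure s ?G = 0}"
      then have s: "0 \<le> s" "hausdorff_measure s ?G = 0" by auto
      have "\<not> s < 1 - 1 / \<tau>"
      proof
        assume less: "s < 1 - 1 / \<tau>"
        \<comment> \<open>At \<open>\<tau> = 1\<close> the claimed dimension is 0, and
          \<open>s < 0\<close> contradicts \<open>0 \<le> s\<close>.\<close>
        then have \<tau>: "\<tau> > 1" using s assms by (cases "\<tau> = 1") auto
        obtain A where A: "A \<ge> 2" "\<And>n. real (card ((\<Union>k. zero_block \<tau> (A ^ Suc k)) \<inter> {..<n})) \<le> (1 - s) * real n + 5"
          using zero_blocks_density[OF \<tau> less] by blast
        have "0 < hausdorff_measure s (spread (\<Union>k. zero_block \<tau> (A ^ Suc k)) ` {0..<1})"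
          using s(1) A(2) by (rule hausdorff_measure_spread_pos)
        also have "\<dots> \<le> hausdorff_measure s ?G"
          by (intro hausdorff_measure_mono spread_subset_large_sum_set A)
        finally show False using s by simp
      qed
      then show "ereal (1 - 1 / \<tau>) \<le> ereal s" by simp
    qed
  qed
qed

end
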